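(* The category $\mathcal R_2$ is the least non-discrete reflective full subcategory of $\mathbf{DCPO}$; that is, $\mathcal R_2$ is a reflective full subcategory of $\mathbf{DCPO}$ containing a non-discrete dcpo, and $\mathcal R_2\subseteq\mathcal K$ for every reflective full subcategory $\mathcal K$ of $\mathbf{DCPO}$ containing a non-discrete dcpo.
   Context: Directed subsets are nonempty; a dcpo is a poset in which every directed subset has a supremum. $\mathbf{DCPO}$ is the category of dcpos and Scott-continuous maps. For dcpos $A,B$, $[A\to B]$ is the dcpo of Scott-continuous maps ordered pointwise. All full subcategories are closed under isomorphisms. A dcpo is discrete if its order is equality, and non-discrete otherwise. A full subcategory $\mathcal K\subseteq\mathbf{DCPO}$ is reflective if for every dcpo $D$ there are $\mathbf LD\in\mathcal K$ and a Scott-continuous map $\kappa_D:D\to\mathbf LD$ such that for every $K\in\mathcal K$ and every Scott-continuous $f:D\to K$ there is a unique Scott-continuous $\widetilde f:\mathbf LD\to K$ with $f=\widetilde f\circ\kappa_D$. Let $2=\{0<1\}$. $E_2$ is the class of all Scott-continuous maps $e:A\to B$ between dcpos such that $e^*:[B\to 2]\to[A\to 2]$, $g\mapsto g\circ e$, is an isomorphism of dcpos (equivalently, $e^{-1}$ is an order isomorphism from the lattice of Scott-open sets of $B$ onto that of $A$). $\mathcal R_2=E_2^{\perp}$ is the full subcategory of $\mathbf{DCPO}$ of all dcpos $C$ such that for every $e:A\to B$ in $E_2$ the map $e^*:[B\to C]\to[A\to C]$, $g\mapsto g\circ e$, is an isomorphism of dcpos. *)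

theory Defs
  imports "HOL-Algebra.Order" "HOL-Library.Equipollence"
begin

text \<open>
  A poset is a \<^typ>\<open>'a gorder\<close> satisfying the locale \<^locale>\<open>partial_order\<close>: a carrier set
  (possibly empty) with an order whose values outside the carrier are irrelevant.
\<close>

definition directed :: "'a gorder \<Rightarrow> 'a set \<Rightarrow> bool" where
  "directed A S \<longleftrightarrow> S \<subseteq> carrier A \<and> S \<noteq> {} \<and>
     (\<forall>x\<in>S. \<forall>y\<in>S. \<exists>z\<in>S. x \<sqsubseteq>\<^bsub>A\<^esub> z \<and> y \<sqsubseteq>\<^bsub>A\<^esub> z)"

definition is_sup :: "'a gorder \<Rightarrow> 'a \<Rightarrow> 'a set \<Rightarrow> bool" where
  "is_sup A s S \<longleftrightarrow> least A s (Upper A S)"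

definition dcpo :: "'a gorder \<Rightarrow> bool" where
  "dcpo A \<longleftrightarrow> partial_order A \<and> (\<forall>S. directed A S \<longrightarrow> (\<exists>s. is_sup A s S))"

definition discrete :: "'a gorder \<Rightarrow> bool" where
  "discrete A \<longleftrightarrow> (\<forall>x\<in>carrier A. \<forall>y\<in>carrier A. x \<sqsubseteq>\<^bsub>A\<^esub> y \<longrightarrow> x = y)"

text \<open>
  Maps are extensional, i.e. \<^const>\<open>undefined\<close> off the carrier of the domain, so that HOL equality of
  maps is equality of maps between the carriers; composites are therefore formed with
  \<^const>\<open>compose\<close>.
\<close>

definition scott_maps :: "'a gorder \<Rightarrow> 'b gorder \<Rightarrow> ('a \<Rightarrow> 'b) set" where
  "scott_maps A B = {f \<in> carrier A \<rightarrow>\<^sub>E carrier B.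
     (\<forall>x\<in>carrier A. \<forall>y\<in>carrier A. x \<sqsubseteq>\<^bsub>A\<^esub> y \<longrightarrow> f x \<sqsubseteq>\<^bsub>B\<^esub> f y) \<and>
     (\<forall>S s. directed A S \<longrightarrow> is_sup A s S \<longrightarrow> is_sup B (f s) (f ` S))}"

definition id_map :: "'a gorder \<Rightarrow> 'a \<Rightarrow> 'a" where
  "id_map A = (\<lambda>x\<in>carrier A. x)"

definition dcpo_iso :: "'a gorder \<Rightarrow> 'b gorder \<Rightarrow> ('a \<Rightarrow> 'b) \<Rightarrow> bool" where
  "dcpo_iso A B h \<longleftrightarrow> h \<in> scott_maps A B \<and>
     (\<exists>k\<in>scott_maps B A. compose (carrier A) k h = id_map A \<and> compose (carrier B) h k = id_map B)"

definition fun_dcpo :: "'a gorder \<Rightarrow> 'b gorder \<Rightarrow> ('a \<Rightarrow> 'b) gorder" where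
  "fun_dcpo A B = \<lparr>carrier = scott_maps A B, eq = (=),
     le = (\<lambda>f g. \<forall>x\<in>carrier A. f x \<sqsubseteq>\<^bsub>B\<^esub> g x)\<rparr>"

definition two :: "bool gorder" where
  "two = \<lparr>carrier = UNIV, eq = (=), le = (\<le>)\<rparr>"

definition precomp :: "'a gorder \<Rightarrow> 'b gorder \<Rightarrow> ('a \<Rightarrow> 'b) \<Rightarrow> 'c gorder \<Rightarrow> ('b \<Rightarrow> 'c) \<Rightarrow> ('a \<Rightarrow> 'c)" where
  "precomp A B e C = (\<lambda>g\<in>scott_maps B C. compose (carrier A) g e)"

text \<open>
  HOL has no type of all sets, so the ambient category of sets is represented by a type \<open>'u\<close>: a set is
  small if it is equipollent to a subset of \<open>'u\<close> of cardinality strictly below that of \<open>'u\<close>, and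
  the objects of DCPO are the dcpos on small subsets of \<open>'u\<close>.  The type is required to be a strong
  limit, so that small sets are closed under power sets, and hence under finite products and
  function spaces.  Every Grothendieck universe has this property (the cardinality of a universe is
  a strong limit, and its members are, up to bijection, exactly the sets of smaller cardinality);
  neither regularity nor uncountability of the cardinality of \<open>'u\<close> is asked for.
\<close>

definition strong_limit :: "'u itself \<Rightarrow> bool" where
  "strong_limit _ \<longleftrightarrow> (\<forall>A::'u set. A \<prec> (UNIV::'u set) \<longrightarrow> Pow A \<prec> (UNIV::'u set))"

definition DCPO :: "'u gorder set" where
  "DCPO = {A. dcpo A \<and> carrier A \<prec> (UNIV::'u set)}"

definition full_subcategory :: "'u gorder set \<Rightarrow> bool" where
  "full_subcategory K \<longleftrightarrow> K \<subseteq> DCPO \<and>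
     (\<forall>A\<in>K. \<forall>B\<in>DCPO. (\<exists>h. dcpo_iso A B h) \<longrightarrow> B \<in> K)"

definition reflective :: "'u gorder set \<Rightarrow> bool" where
  "reflective K \<longleftrightarrow> full_subcategory K \<and>
     (\<forall>D\<in>(DCPO :: 'u gorder set). \<exists>L\<in>K. \<exists>\<kappa>\<in>scott_maps D L. \<forall>C\<in>K. \<forall>f\<in>scott_maps D C.
        \<exists>!g. g \<in> scott_maps L C \<and> f = compose (carrier D) g \<kappa>)"

definition E2 :: "'u gorder \<Rightarrow> 'u gorder \<Rightarrow> ('u \<Rightarrow> 'u) set" where
  "E2 A B = {e \<in> scott_maps A B. dcpo_iso (fun_dcpo B two) (fun_dcpo A two) (precomp A B e two)}"

definition R2 :: "'u gorder set" where
  "R2 = {C \<in> DCPO. \<forall>A\<in>(DCPO :: 'u gorder set). \<forall>B\<in>(DCPO :: 'u gorder set). \<forall>e\<in>E2 A B.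
     dcpo_iso (fun_dcpo B C) (fun_dcpo A C) (precomp A B e C)}"

end

theory Submission
  imports Defs
begin

text \<open>
  A dcpo \<open>X\<close> embeds into the power set of its Scott-continuous maps to \<open>two\<close>, a power of \<open>two\<close> and
  hence orthogonal to \<open>E2\<close>.  Sub-dcpos orthogonal to \<open>E2\<close> are closed under intersections,
  equalizers and preimages, so the least one containing the image of \<open>X\<close> is the reflection of \<open>X\<close>;
  being a set of sets of maps to \<open>two\<close>, it is small.

  A reflective full subcategory is closed under retracts, and \<open>two\<close> is a retract of every
  non-discrete dcpo.  Once \<open>two\<close> lies in \<open>K\<close>, every reflection map \<open>\<kappa> : C \<rightarrow> L\<close> into \<open>K\<close> is in \<open>E2\<close>;
  if \<open>C\<close> is in \<open>R2\<close>, the identity of \<open>C\<close> therefore extends along \<open>\<kappa>\<close>, so \<open>C\<close> is a retract of \<open>L\<close>.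
\<close>

section \<open>Scott-continuous maps\<close>

lemma partial_orderI:
  assumes "eq A = (=)" "\<And>x. x \<in> carrier A \<Longrightarrow> x \<sqsubseteq>\<^bsub>A\<^esub> x"
    "\<And>x y. x \<in> carrier A \<Longrightarrow> y \<in> carrier A \<Longrightarrow> x \<sqsubseteq>\<^bsub>A\<^esub> y \<Longrightarrow> y \<sqsubseteq>\<^bsub>A\<^esub> x \<Longrightarrow> x = y"
    "\<And>x y z. x \<in> carrier A \<Longrightarrow> y \<in> carrier A \<Longrightarrow> z \<in> carrier A \<Longrightarrow>
      x \<sqsubseteq>\<^bsub>A\<^esub> y \<Longrightarrow> y \<sqsubseteq>\<^bsub>A\<^esub> z \<Longrightarrow> x \<sqsubseteq>\<^bsub>A\<^esub> z"
  shows "partial_order A"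
  by unfold_locales (simp_all add: assms(1-3), rule assms(4))

lemma refl_le: "partial_order A \<Longrightarrow> x \<in> carrier A \<Longrightarrow> x \<sqsubseteq>\<^bsub>A\<^esub> x"
  by (rule weak_partial_order.le_refl[OF partial_order.axioms(1)])

lemma antisym_le:
  "partial_order A \<Longrightarrow> x \<sqsubseteq>\<^bsub>A\<^esub> y \<Longrightarrow> y \<sqsubseteq>\<^bsub>A\<^esub> x \<Longrightarrow> x \<in> carrier A \<Longrightarrow> y \<in> carrier A \<Longrightarrow> x = y"
  by (rule partial_order.le_antisym)

lemma trans_le:
  "partial_order A \<Longrightarrow> x \<sqsubseteq>\<^bsub>A\<^esub> y \<Longrightarrow> y \<sqsubseteq>\<^bsub>A\<^esub> z \<Longrightarrow>
    x \<in> carrier A \<Longrightarrow> y \<in> carrier A \<Longrightarrow> z \<in> carrier A \<Longrightarrow> x \<sqsubseteq>\<^bsub>A\<^esub> z"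
  by (rule weak_partial_order.le_trans[OF partial_order.axioms(1)])

lemma dcpo_partial_order: "dcpo A \<Longrightarrow> partial_order A"
  by (simp add: dcpo_def)

lemma DCPO_partial_order: "A \<in> DCPO \<Longrightarrow> partial_order A"
  by (simp add: DCPO_def dcpo_def)

text \<open>\<open>Upper\<close> ignores members of \<open>S\<close> outside the carrier, so the
  usual description of a supremum is stated for \<open>S\<close> inside it.\<close>

lemma is_sup_iff:
  assumes "S \<subseteq> carrier A"
  shows "is_sup A s S \<longleftrightarrow> s \<in> carrier A \<and> (\<forall>x\<in>S. x \<sqsubseteq>\<^bsub>A\<^esub> s) \<and>
    (\<forall>u\<in>carrier A. (\<forall>x\<in>S. x \<sqsubseteq>\<^bsub>A\<^esub> u) \<longrightarrow> s \<sqsubseteq>\<^bsub>A\<^esub> u)"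
  using assms unfolding is_sup_def least_def Upper_def by blast

lemma is_sup_unique:
  assumes "partial_order A" "is_sup A s S" "is_sup A t S"
  shows "s = t"
  using assms(2,3) unfolding is_sup_def least_def
  by (intro antisym_le[OF assms(1)]) (auto simp: Upper_def)

lemma directed_subset: "directed A S \<Longrightarrow> S \<subseteq> carrier A"
  by (simp add: directed_def)

lemma scott_mapsI:
  assumes "f \<in> extensional (carrier A)" "\<And>x. x \<in> carrier A \<Longrightarrow> f x \<in> carrier B"
    "\<And>x y. x \<in> carrier A \<Longrightarrow> y \<in> carrier A \<Longrightarrow> x \<sqsubseteq>\<^bsub>A\<^esub> y \<Longrightarrow> f x \<sqsubseteq>\<^bsub>B\<^esub> f y"
    "\<And>S s. directed A S \<Longrightarrow> is_sup A s S \<Longrightarrow> is_sup B (f s) (f ` S)"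
  shows "f \<in> scott_maps A B"
  using assms by (auto simp: scott_maps_def PiE_def)

lemma scott_maps_closed: "f \<in> scott_maps A B \<Longrightarrow> x \<in> carrier A \<Longrightarrow> f x \<in> carrier B"
  by (auto simp: scott_maps_def)

lemma scott_maps_mono:
  "f \<in> scott_maps A B \<Longrightarrow> x \<in> carrier A \<Longrightarrow> y \<in> carrier A \<Longrightarrow> x \<sqsubseteq>\<^bsub>A\<^esub> y \<Longrightarrow> f x \<sqsubseteq>\<^bsub>B\<^esub> f y"
  by (auto simp: scott_maps_def)

lemma scott_maps_sup:
  "f \<in> scott_maps A B \<Longrightarrow> directed A S \<Longrightarrow> is_sup A s S \<Longrightarrow> is_sup B (f s) (f ` S)"
  by (auto simp: scott_maps_def)

lemma scott_maps_extensional: "f \<in> scott_maps A B \<Longrightarrow> f \<in> extensional (carrier A)"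
  by (auto simp: scott_maps_def PiE_def)

lemma scott_maps_eqI:
  assumes "f \<in> scott_maps A B" "g \<in> scott_maps A C" "\<And>x. x \<in> carrier A \<Longrightarrow> f x = g x"
  shows "f = g"
  using assms by (meson extensionalityI scott_maps_extensional)

lemma compose_eqD: "f = compose A g e \<Longrightarrow> a \<in> A \<Longrightarrow> g (e a) = f a"
  by (simp add: compose_eq)

text \<open>Stated for monotone maps, because it is also applied to maps whose continuity is not yet
  established.\<close>

lemma directed_mono_image:
  assumes closed: "\<And>x. x \<in> carrier A \<Longrightarrow> f x \<in> carrier B"
    and mono: "\<And>x y. x \<in> carrier A \<Longrightarrow> y \<in> carrier A \<Longrightarrow> x \<sqsubseteq>\<^bsub>A\<^esub> y \<Longrightarrow> f x \<sqsubseteq>\<^bsub>B\<^esub> f y"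
    and dir: "directed A S"
  shows "directed B (f ` S)"
  unfolding directed_def
proof (intro conjI)
  have S: "S \<subseteq> carrier A" "S \<noteq> {}"
    using dir by (auto simp: directed_def)
  then show "f ` S \<subseteq> carrier B" "f ` S \<noteq> {}"
    using closed by auto
  have "\<exists>z\<in>S. f x \<sqsubseteq>\<^bsub>B\<^esub> f z \<and> f y \<sqsubseteq>\<^bsub>B\<^esub> f z" if xy: "x \<in> S" "y \<in> S" for x y
  proof -
    obtain z where "z \<in> S" "x \<sqsubseteq>\<^bsub>A\<^esub> z" "y \<sqsubseteq>\<^bsub>A\<^esub> z"
      using dir xy unfolding directed_def by blast
    then show ?thesis
      using S xy mono by blast
  qed
  then show "\<forall>x\<in>f ` S. \<forall>y\<in>f ` S. \<exists>z\<in>f ` S. x \<sqsubseteq>\<^bsub>B\<^esub> z \<and> y \<sqsubseteq>\<^bsub>B\<^esub> z"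
    by simp
qed

lemma directed_image: "f \<in> scott_maps A B \<Longrightarrow> directed A S \<Longrightarrow> directed B (f ` S)"
  by (rule directed_mono_image[OF scott_maps_closed scott_maps_mono])

lemma compose_scott_maps:
  assumes f: "f \<in> scott_maps A B" and g: "g \<in> scott_maps B C"
  shows "compose (carrier A) g f \<in> scott_maps A C"
proof -
  have "is_sup C (compose (carrier A) g f s) (compose (carrier A) g f ` S)"
    if S: "directed A S" and s: "is_sup A s S" for S s
  proof -
    have "is_sup C (g (f s)) (g ` f ` S)"
      using scott_maps_sup[OF g directed_image[OF f S] scott_maps_sup[OF f S s]] .
    moreover have "s \<in> carrier A"
      using s S by (simp add: is_sup_iff directed_subset)
    moreover have "compose (carrier A) g f ` S = g ` f ` S"
      using directed_subset[OF S] by (force simp: compose_eq image_image subset_iff)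
    ultimately show ?thesis
      by (simp add: compose_eq)
  qed
  then show ?thesis
    using scott_maps_closed[OF f] scott_maps_mono[OF f] scott_maps_closed[OF g] scott_maps_mono[OF g]
    by (auto simp: scott_maps_def compose_eq compose_def)
qed

lemma id_map_scott: "id_map A \<in> scott_maps A A"
proof -
  have "is_sup A (id_map A s) (id_map A ` S)" if "directed A S" "is_sup A s S" for S s
  proof -
    have "id_map A ` S = S" "id_map A s = s"
      using that by (auto simp: id_map_def is_sup_iff directed_subset dest!: directed_subset)
    then show ?thesis using that by simp
  qed
  then show ?thesis
    by (auto simp: scott_maps_def id_map_def)
qed

text \<open>Directed sets are nonempty, so the image of one is exactly \<open>{c}\<close>, whose
  supremum is \<open>c\<close>.\<close>

lemma const_scott:
  assumes "partial_order B" "c \<in> carrier B"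
  shows "(\<lambda>x\<in>carrier A. c) \<in> scott_maps A B"
proof -
  have "is_sup B ((\<lambda>x\<in>carrier A. c) s) ((\<lambda>x\<in>carrier A. c) ` S)"
    if "directed A S" "is_sup A s S" for S s
  proof -
    have "(\<lambda>x\<in>carrier A. c) ` S = {c}" "(\<lambda>x\<in>carrier A. c) s = c"
      using that by (auto simp: is_sup_iff directed_subset directed_def)
    then show ?thesis
      using assms by (simp add: is_sup_iff refl_le)
  qed
  then show ?thesis
    using assms by (intro scott_mapsI) (simp_all add: refl_le)
qed

section \<open>Isomorphisms\<close>

lemma order_iso_sup:
  assumes h: "h ` carrier P = carrier Q"
    "\<And>x y. x \<in> carrier P \<Longrightarrow> y \<in> carrier P \<Longrightarrow> x \<sqsubseteq>\<^bsub>P\<^esub> y \<longleftrightarrow> h x \<sqsubseteq>\<^bsub>Q\<^esub> h y"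
    and S: "S \<subseteq> carrier P" "is_sup P s S"
  shows "is_sup Q (h s) (h ` S)"
proof -
  have "h ` S \<subseteq> carrier Q"
    unfolding h(1)[symmetric] using S(1) by (rule image_mono)
  moreover have "h s \<sqsubseteq>\<^bsub>Q\<^esub> u" if "u \<in> carrier Q" "\<forall>x\<in>h ` S. x \<sqsubseteq>\<^bsub>Q\<^esub> u" for u
  proof -
    obtain v where "v \<in> carrier P" "u = h v"
      using h(1) \<open>u \<in> carrier Q\<close> by blast
    then show ?thesis
      using that h(2) S by (auto simp: is_sup_iff subset_iff)
  qed
  ultimately show ?thesis
    using h S by (auto simp: is_sup_iff subset_iff)
qed

text \<open>An order isomorphism preserves all existing suprema, hence it and its inverse are
  Scott-continuous. Only partial orders are asked for, so that this applies to function spaces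
  without a proof of their completeness.\<close>

lemma dcpo_isoI:
  assumes PQ: "partial_order P" "partial_order Q"
    and h: "h \<in> extensional (carrier P)" "h ` carrier P = carrier Q"
    "\<And>x y. x \<in> carrier P \<Longrightarrow> y \<in> carrier P \<Longrightarrow> x \<sqsubseteq>\<^bsub>P\<^esub> y \<longleftrightarrow> h x \<sqsubseteq>\<^bsub>Q\<^esub> h y"
  shows "dcpo_iso P Q h"
proof -
  have inj: "inj_on h (carrier P)"
    using h(3) PQ(1) by (intro inj_onI) (metis antisym_le refl_le)
  define k where "k = (\<lambda>y\<in>carrier Q. inv_into (carrier P) h y)"
  have kh: "k (h x) = x" if "x \<in> carrier P" for x
    using that h(2) inj by (auto simp: k_def)
  have hk: "h (k y) = y" "k y \<in> carrier P" if "y \<in> carrier Q" for y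
    using that kh unfolding h(2)[symmetric] by auto
  have k3: "x \<sqsubseteq>\<^bsub>Q\<^esub> y \<longleftrightarrow> k x \<sqsubseteq>\<^bsub>P\<^esub> k y" if "x \<in> carrier Q" "y \<in> carrier Q" for x y
    using that h(3) hk by auto
  have k2: "k ` carrier Q = carrier P"
    using hk kh h(2) by force
  have "h \<in> scott_maps P Q"
    by (intro scott_mapsI order_iso_sup[of h P Q, OF h(2,3)])
      (use h in \<open>auto dest: directed_subset\<close>)
  moreover have "k \<in> scott_maps Q P"
    by (intro scott_mapsI order_iso_sup[of k Q P, OF k2 k3])
      (use hk k3 in \<open>auto simp: k_def dest: directed_subset\<close>)
  moreover have "compose (carrier P) k h = id_map P" "compose (carrier Q) h k = id_map Q"
    using kh hk by (auto simp: compose_def id_map_def fun_eq_iff)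
  ultimately show ?thesis
    unfolding dcpo_iso_def by blast
qed

lemma dcpo_isoE:
  assumes "dcpo_iso A B h"
  obtains k where "h \<in> scott_maps A B" "k \<in> scott_maps B A"
    "\<And>x. x \<in> carrier A \<Longrightarrow> k (h x) = x" "\<And>y. y \<in> carrier B \<Longrightarrow> h (k y) = y"
proof -
  obtain k where k: "h \<in> scott_maps A B" "k \<in> scott_maps B A"
      "compose (carrier A) k h = id_map A" "compose (carrier B) h k = id_map B"
    using assms unfolding dcpo_iso_def by blast
  show thesis
    using that[OF k(1,2)] k(3,4) by (metis compose_eq id_map_def restrict_apply')
qed

text \<open>The hull and \<open>two\<close> live on types other than \<open>'u\<close>. Pulling the
  order back along an injection into \<open>'u\<close> turns a small dcpo into an object of
  \<open>DCPO\<close>.\<close>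

lemma dcpo_transport:
  fixes C :: "'c gorder"
  assumes C: "dcpo C" and small: "carrier C \<prec> (UNIV :: 'u set)"
  shows "\<exists>D\<in>(DCPO :: 'u gorder set). \<exists>h. dcpo_iso C D h"
proof -
  obtain \<phi> :: "'c \<Rightarrow> 'u" where inj: "inj_on \<phi> (carrier C)"
    using small by (auto simp: lesspoll_def lepoll_def)
  define \<psi> where "\<psi> = inv_into (carrier C) \<phi>"
  have \<psi>: "\<psi> (\<phi> x) = x" if "x \<in> carrier C" for x
    using that inj by (simp add: \<psi>_def)
  define D :: "'u gorder" where "D = \<lparr>carrier = \<phi> ` carrier C, eq = (=), le = (\<lambda>x y. \<psi> x \<sqsubseteq>\<^bsub>C\<^esub> \<psi> y)\<rparr>"
  have D: "carrier D = \<phi> ` carrier C" "\<And>x y. x \<sqsubseteq>\<^bsub>D\<^esub> y \<longleftrightarrow> \<psi> x \<sqsubseteq>\<^bsub>C\<^esub> \<psi> y" "eq D = (=)"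
    by (auto simp: D_def)
  have pC: "partial_order C"
    using C by (rule dcpo_partial_order)
  have pD: "partial_order D"
    by (rule partial_orderI)
      (auto simp: D \<psi> intro: refl_le[OF pC] trans_le[OF pC] dest: antisym_le[OF pC])
  have "\<exists>s. is_sup D s S" if S: "directed D S" for S
  proof -
    have "directed C (\<psi> ` S)"
      by (rule directed_mono_image[OF _ _ S]) (auto simp: D \<psi>)
    then obtain s where "is_sup C s (\<psi> ` S)"
      using C dcpo_def by blast
    then have "is_sup D (\<phi> s) (\<phi> ` \<psi> ` S)"
      using \<open>directed C (\<psi> ` S)\<close> by (intro order_iso_sup) (auto simp: D \<psi> directed_subset)
    moreover have "\<phi> ` \<psi> ` S = S"
      using directed_subset[OF S] by (force simp: D \<psi> image_image)
    ultimately show ?thesis by auto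
  qed
  moreover have "carrier D \<prec> (UNIV :: 'u set)"
    using inj small by (simp add: D)
  ultimately have "D \<in> DCPO"
    using pD by (simp add: DCPO_def dcpo_def)
  moreover have "dcpo_iso C D (restrict \<phi> (carrier C))"
    by (rule dcpo_isoI[OF pC pD]) (auto simp: D \<psi>)
  ultimately show ?thesis by blast
qed

section \<open>Orthogonality\<close>

text \<open>Spells out invertibility of precomposition with \<open>e\<close>: extensions exist, and
  the order is reflected. Reflection of the order contains uniqueness, by antisymmetry. The type of
  \<open>C\<close> is free, so power sets over other types can be tested as well.\<close>

definition orthogonal :: "'a gorder \<Rightarrow> 'b gorder \<Rightarrow> ('a \<Rightarrow> 'b) \<Rightarrow> 'c gorder \<Rightarrow> bool" where
  "orthogonal A B e C \<longleftrightarrow>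
     (\<forall>f\<in>scott_maps A C. \<exists>g\<in>scott_maps B C. f = compose (carrier A) g e) \<and>
     (\<forall>g\<in>scott_maps B C. \<forall>h\<in>scott_maps B C.
        (\<forall>a\<in>carrier A. g (e a) \<sqsubseteq>\<^bsub>C\<^esub> h (e a)) \<longrightarrow> (\<forall>b\<in>carrier B. g b \<sqsubseteq>\<^bsub>C\<^esub> h b))"

lemma orthogonal_ex:
  assumes "orthogonal A B e C" "f \<in> scott_maps A C"
  obtains g where "g \<in> scott_maps B C" "f = compose (carrier A) g e"
  using assms unfolding orthogonal_def by blast

lemma orthogonal_le:
  assumes "orthogonal A B e C" "g \<in> scott_maps B C" "h \<in> scott_maps B C"
    "\<And>a. a \<in> carrier A \<Longrightarrow> g (e a) \<sqsubseteq>\<^bsub>C\<^esub> h (e a)" "b \<in> carrier B"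
  shows "g b \<sqsubseteq>\<^bsub>C\<^esub> h b"
  using assms unfolding orthogonal_def by blast

lemma orthogonal_eq:
  assumes "partial_order C" "e \<in> scott_maps A B" "orthogonal A B e C"
    "g \<in> scott_maps B C" "h \<in> scott_maps B C"
    "\<And>a. a \<in> carrier A \<Longrightarrow> g (e a) = h (e a)" "b \<in> carrier B"
  shows "g b = h b"
proof (rule antisym_le[OF assms(1)])
  have "h (e a) \<in> carrier C" if "a \<in> carrier A" for a
    by (rule scott_maps_closed[OF assms(5) scott_maps_closed[OF assms(2) that]])
  then have le: "g (e a) \<sqsubseteq>\<^bsub>C\<^esub> h (e a)" "h (e a) \<sqsubseteq>\<^bsub>C\<^esub> g (e a)" if "a \<in> carrier A" for a
    using that by (simp_all add: assms(6) refl_le[OF assms(1)])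
  show "g b \<sqsubseteq>\<^bsub>C\<^esub> h b"
    by (rule orthogonal_le[OF assms(3-5) le(1) assms(7)])
  show "h b \<sqsubseteq>\<^bsub>C\<^esub> g b"
    by (rule orthogonal_le[OF assms(3,5,4) le(2) assms(7)])
  show "g b \<in> carrier C" "h b \<in> carrier C"
    by (rule scott_maps_closed[OF assms(4,7)], rule scott_maps_closed[OF assms(5,7)])
qed

lemma partial_order_fun_dcpo:
  assumes C: "partial_order C"
  shows "partial_order (fun_dcpo A C)"
proof -
  have le: "f \<sqsubseteq>\<^bsub>fun_dcpo A C\<^esub> g \<longleftrightarrow> (\<forall>x\<in>carrier A. f x \<sqsubseteq>\<^bsub>C\<^esub> g x)"
    and c: "carrier (fun_dcpo A C) = scott_maps A C" for f g
    by (simp_all add: fun_dcpo_def)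
  show ?thesis
  proof (rule partial_orderI, unfold le c)
    fix f assume "f \<in> scott_maps A C"
    then show "\<forall>x\<in>carrier A. f x \<sqsubseteq>\<^bsub>C\<^esub> f x"
      by (simp add: refl_le[OF C] scott_maps_closed)
  next
    fix f g assume fg: "f \<in> scott_maps A C" "g \<in> scott_maps A C"
      and le: "\<forall>x\<in>carrier A. f x \<sqsubseteq>\<^bsub>C\<^esub> g x" "\<forall>x\<in>carrier A. g x \<sqsubseteq>\<^bsub>C\<^esub> f x"
    show "f = g"
    proof (rule scott_maps_eqI[OF fg])
      fix x assume "x \<in> carrier A"
      then show "f x = g x"
        using fg le by (intro antisym_le[OF C]) (simp_all add: scott_maps_closed)
    qed
  next
    fix f g h assume fgh: "f \<in> scott_maps A C" "g \<in> scott_maps A C" "h \<in> scott_maps A C"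
      and le: "\<forall>x\<in>carrier A. f x \<sqsubseteq>\<^bsub>C\<^esub> g x" "\<forall>x\<in>carrier A. g x \<sqsubseteq>\<^bsub>C\<^esub> h x"
    show "\<forall>x\<in>carrier A. f x \<sqsubseteq>\<^bsub>C\<^esub> h x"
    proof
      fix x assume "x \<in> carrier A"
      then show "f x \<sqsubseteq>\<^bsub>C\<^esub> h x"
        using fgh le by (intro trans_le[OF C, of "f x" "g x" "h x"]) (simp_all add: scott_maps_closed)
    qed
  qed (simp add: fun_dcpo_def)
qed

text \<open>Precomposition is always monotone, so surjectivity and order reflection make it an order
  isomorphism. Conversely, a Scott-continuous inverse is monotone, which is order
  reflection.\<close>

lemma dcpo_iso_precomp_iff:
  assumes C: "partial_order C" and e: "e \<in> scott_maps A B"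
  shows "dcpo_iso (fun_dcpo B C) (fun_dcpo A C) (precomp A B e C) \<longleftrightarrow> orthogonal A B e C"
    (is "dcpo_iso ?P ?Q ?h \<longleftrightarrow> _")
proof
  have c: "carrier ?P = scott_maps B C" "carrier ?Q = scott_maps A C"
    by (auto simp: fun_dcpo_def)
  have h: "?h g = compose (carrier A) g e" if "g \<in> scott_maps B C" for g
    using that by (simp add: precomp_def)
  {
    assume "dcpo_iso ?P ?Q ?h"
    then obtain k where k: "k \<in> scott_maps ?Q ?P"
        "\<And>g. g \<in> scott_maps B C \<Longrightarrow> k (?h g) = g" "\<And>f. f \<in> scott_maps A C \<Longrightarrow> ?h (k f) = f"
      by (elim dcpo_isoE) (auto simp: c)
    have kc: "k f \<in> scott_maps B C" if "f \<in> scott_maps A C" for f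
      using scott_maps_closed[OF k(1)] that by (simp add: c)
    show "orthogonal A B e C"
      unfolding orthogonal_def
    proof (intro conjI ballI impI)
      fix f assume "f \<in> scott_maps A C"
      then show "\<exists>g\<in>scott_maps B C. f = compose (carrier A) g e"
        using k(3) kc h by metis
    next
      fix g g' b
      assume g: "g \<in> scott_maps B C" "g' \<in> scott_maps B C" "b \<in> carrier B"
        and le: "\<forall>a\<in>carrier A. g (e a) \<sqsubseteq>\<^bsub>C\<^esub> g' (e a)"
      have "?h g \<sqsubseteq>\<^bsub>?Q\<^esub> ?h g'"
        using le g by (simp add: fun_dcpo_def h compose_eq)
      then have "k (?h g) \<sqsubseteq>\<^bsub>?P\<^esub> k (?h g')"
        using g e by (intro scott_maps_mono[OF k(1)]) (auto simp: c h compose_scott_maps)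
      then show "g b \<sqsubseteq>\<^bsub>C\<^esub> g' b"
        using g k(2) by (simp add: fun_dcpo_def)
    qed
  }
  assume o: "orthogonal A B e C"
  show "dcpo_iso ?P ?Q ?h"
  proof (rule dcpo_isoI[OF partial_order_fun_dcpo[OF C] partial_order_fun_dcpo[OF C]])
    show "?h \<in> extensional (carrier ?P)"
      by (simp add: precomp_def c)
    show "?h ` carrier ?P = carrier ?Q"
    proof (intro equalityI subsetI)
      fix f assume "f \<in> ?h ` carrier ?P"
      then show "f \<in> carrier ?Q"
        by (auto simp: c h intro: compose_scott_maps[OF e])
    next
      fix f assume "f \<in> carrier ?Q"
      then obtain g where "g \<in> scott_maps B C" "f = compose (carrier A) g e"
        using orthogonal_ex[OF o] unfolding c by blast
      then show "f \<in> ?h ` carrier ?P"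
        using h unfolding c by (metis imageI)
    qed
    fix f g
    assume "f \<in> carrier ?P" "g \<in> carrier ?P"
    then show "f \<sqsubseteq>\<^bsub>?P\<^esub> g \<longleftrightarrow> ?h f \<sqsubseteq>\<^bsub>?Q\<^esub> ?h g"
      using orthogonal_le[OF o] scott_maps_closed[OF e]
      by (auto simp: c h compose_eq) (auto simp: fun_dcpo_def compose_eq)
  qed
qed

text \<open>A map into \<open>D\<close> is sent to \<open>C\<close> by \<open>k\<close>, extended
  there, and brought back by \<open>h\<close>; comparisons travel the same way.\<close>

lemma orthogonal_transport:
  assumes e: "e \<in> scott_maps A B" and C: "orthogonal A B e C" and iso: "dcpo_iso C D h"
  shows "orthogonal A B e D"
proof -
  obtain k where h: "h \<in> scott_maps C D" and k: "k \<in> scott_maps D C"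
    and "\<And>x. x \<in> carrier C \<Longrightarrow> k (h x) = x" and hk: "\<And>y. y \<in> carrier D \<Longrightarrow> h (k y) = y"
    using iso by (rule dcpo_isoE) blast
  show ?thesis
    unfolding orthogonal_def
  proof (intro conjI ballI impI)
    fix f assume f: "f \<in> scott_maps A D"
    obtain g where g: "g \<in> scott_maps B C" "compose (carrier A) k f = compose (carrier A) g e"
      using orthogonal_ex[OF C compose_scott_maps[OF f k]] .
    have "f = compose (carrier A) (compose (carrier B) h g) e"
    proof (rule scott_maps_eqI[OF f compose_scott_maps[OF e compose_scott_maps[OF g(1) h]]])
      fix a assume a: "a \<in> carrier A"
      then have "g (e a) = k (f a)"
        using g(2) by (metis compose_eq)
      then show "f a = compose (carrier A) (compose (carrier B) h g) e a"
        using a hk scott_maps_closed[OF f] scott_maps_closed[OF e] by (simp add: compose_eq)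
    qed
    then show "\<exists>g\<in>scott_maps B D. f = compose (carrier A) g e"
      using compose_scott_maps[OF g(1) h] by blast
  next
    fix g g' b
    assume g: "g \<in> scott_maps B D" "g' \<in> scott_maps B D" and b: "b \<in> carrier B"
      and le: "\<forall>a\<in>carrier A. g (e a) \<sqsubseteq>\<^bsub>D\<^esub> g' (e a)"
    have "compose (carrier B) k g b \<sqsubseteq>\<^bsub>C\<^esub> compose (carrier B) k g' b"
      by (rule orthogonal_le[OF C compose_scott_maps[OF g(1) k] compose_scott_maps[OF g(2) k] _ b])
        (use g e le in \<open>auto simp: compose_eq scott_maps_closed intro!: scott_maps_mono[OF k]\<close>)
    then have "h (k (g b)) \<sqsubseteq>\<^bsub>D\<^esub> h (k (g' b))"
      using b g k by (auto simp: compose_eq scott_maps_closed intro!: scott_maps_mono[OF h])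
    then show "g b \<sqsubseteq>\<^bsub>D\<^esub> g' b"
      using hk b g by (simp add: scott_maps_closed)
  qed
qed

section \<open>Membership in \<open>E2\<close> and \<open>R2\<close> in terms of
  orthogonality\<close>

lemma partial_order_two: "partial_order two"
  by (rule partial_orderI) (auto simp: two_def)

lemma E2_iff: "e \<in> E2 A B \<longleftrightarrow> e \<in> scott_maps A B \<and> orthogonal A B e two"
  by (auto simp: E2_def dcpo_iso_precomp_iff[OF partial_order_two])

lemma R2_iff:
  fixes C :: "'u gorder"
  shows "C \<in> R2 \<longleftrightarrow> C \<in> DCPO \<and>
    (\<forall>A\<in>(DCPO :: 'u gorder set). \<forall>B\<in>(DCPO :: 'u gorder set). \<forall>e\<in>E2 A B. orthogonal A B e C)"
  by (auto simp: R2_def E2_iff dcpo_iso_precomp_iff[OF DCPO_partial_order])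

lemma R2_orthogonal:
  fixes C :: "'u gorder"
  assumes "C \<in> R2" "A \<in> (DCPO :: 'u gorder set)" "B \<in> (DCPO :: 'u gorder set)" "e \<in> E2 A B"
  shows "orthogonal A B e C"
  using assms by (simp add: R2_iff)

text \<open>\<open>R2\<close> contains only dcpos on \<open>'u\<close>. Orthogonality is proved
  where a dcpo is constructed, and this lemma passes it to a copy on \<open>'u\<close>.\<close>

lemma R2_transport:
  fixes C :: "'c gorder" and D :: "'u gorder"
  assumes "\<And>A B (e :: 'u \<Rightarrow> 'u). A \<in> DCPO \<Longrightarrow> B \<in> DCPO \<Longrightarrow> e \<in> E2 A B \<Longrightarrow> orthogonal A B e C"
    and "D \<in> DCPO" "dcpo_iso C D h"
  shows "D \<in> R2"
  unfolding R2_iff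
proof (intro conjI ballI)
  fix A B e assume "A \<in> (DCPO :: 'u gorder set)" "B \<in> (DCPO :: 'u gorder set)" "e \<in> E2 A B"
  then show "orthogonal A B e D"
    using orthogonal_transport[OF _ assms(1,3)] by (simp add: E2_iff)
qed (rule assms(2))

lemma full_subcategory_R2: "full_subcategory R2"
  unfolding full_subcategory_def using R2_transport R2_iff by blast

section \<open>Powers of the two-element chain\<close>

text \<open>With \<open>M = UNIV\<close> this is the power of \<open>two\<close> indexed by the type
  \<open>'i\<close>; the other families are its subposets.\<close>

definition sets_order :: "'i set set \<Rightarrow> 'i set gorder" where
  "sets_order M = \<lparr>carrier = M, eq = (=), le = (\<subseteq>)\<rparr>"

lemma sets_order_simps [simp]:
  "carrier (sets_order M) = M" "eq (sets_order M) = (=)" "le (sets_order M) = (\<subseteq>)"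
  by (auto simp: sets_order_def)

text \<open>Says that \<open>M\<close> is a sub-dcpo of the power set, with directed suprema
  computed as unions.\<close>

definition union_closed :: "'i set set \<Rightarrow> bool" where
  "union_closed M \<longleftrightarrow> (\<forall>S. directed (sets_order M) S \<longrightarrow> \<Union>S \<in> M)"

lemma union_closed_UNIV: "union_closed UNIV"
  by (simp add: union_closed_def)

lemma partial_order_sets_order: "partial_order (sets_order M)"
  by (rule partial_orderI) auto

lemma is_sup_sets_order:
  assumes "union_closed M" "directed (sets_order M) S"
  shows "is_sup (sets_order M) s S \<longleftrightarrow> s = \<Union>S"
proof -
  have "is_sup (sets_order M) (\<Union>S) S"
    using assms directed_subset[OF assms(2)] by (auto simp: is_sup_iff union_closed_def)
  then show ?thesis
    using is_sup_unique[OF partial_order_sets_order] by blast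
qed

lemma dcpo_sets_order: "union_closed M \<Longrightarrow> dcpo (sets_order M)"
  using is_sup_sets_order partial_order_sets_order unfolding dcpo_def by blast

lemma scott_sets_order_iff:
  assumes M: "union_closed M"
  shows "f \<in> scott_maps A (sets_order M) \<longleftrightarrow> f \<in> extensional (carrier A) \<and>
    (\<forall>x\<in>carrier A. f x \<in> M) \<and>
    (\<forall>x\<in>carrier A. \<forall>y\<in>carrier A. x \<sqsubseteq>\<^bsub>A\<^esub> y \<longrightarrow> f x \<subseteq> f y) \<and>
    (\<forall>S s. directed A S \<longrightarrow> is_sup A s S \<longrightarrow> f s = \<Union>(f ` S))" (is "?L \<longleftrightarrow> ?R")
proof
  assume f: ?L
  have "f s = \<Union>(f ` S)" if "directed A S" "is_sup A s S" for S s
    using is_sup_sets_order[OF M directed_image[OF f that(1)]] scott_maps_sup[OF f that] by simp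
  then show ?R
    using scott_maps_extensional[OF f] scott_maps_closed[OF f] scott_maps_mono[OF f] by simp
next
  assume f: ?R
  have "directed (sets_order M) (f ` S)" if "directed A S" for S
    using f that by (intro directed_mono_image[of A f]) auto
  then show ?L
    using f is_sup_sets_order[OF M] by (intro scott_mapsI) auto
qed

section \<open>Maps to \<open>two\<close> as indicators of Scott-open sets, and maps into powers of
  \<open>two\<close>\<close>

lemma is_sup_two: "is_sup two s S \<longleftrightarrow> s = (\<exists>x\<in>S. x)"
  by (subst is_sup_iff) (auto simp: two_def)

lemma scott_two_iff:
  "p \<in> scott_maps A two \<longleftrightarrow> p \<in> extensional (carrier A) \<and>
    (\<forall>x\<in>carrier A. \<forall>y\<in>carrier A. x \<sqsubseteq>\<^bsub>A\<^esub> y \<longrightarrow> p x \<longrightarrow> p y) \<and>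
    (\<forall>S s. directed A S \<longrightarrow> is_sup A s S \<longrightarrow> p s = (\<exists>x\<in>S. p x))"
  unfolding scott_maps_def is_sup_two PiE_def by (auto simp: two_def)

lemma scott_twoI:
  assumes "p \<in> extensional (carrier A)"
    "\<And>x y. x \<in> carrier A \<Longrightarrow> y \<in> carrier A \<Longrightarrow> x \<sqsubseteq>\<^bsub>A\<^esub> y \<Longrightarrow> p x \<Longrightarrow> p y"
    "\<And>S s. directed A S \<Longrightarrow> is_sup A s S \<Longrightarrow> p s = (\<exists>x\<in>S. p x)"
  shows "p \<in> scott_maps A two"
  using assms unfolding scott_two_iff by auto

lemma scott_two_sup:
  "p \<in> scott_maps A two \<Longrightarrow> directed A S \<Longrightarrow> is_sup A s S \<Longrightarrow> p s = (\<exists>x\<in>S. p x)"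
  by (simp add: scott_two_iff)

text \<open>Order and directed suprema of a power of \<open>two\<close> are computed coordinatewise,
  hence so is continuity; membership of \<open>i\<close> is the coordinate at
  \<open>i\<close>.\<close>

lemma scott_sets_order_UNIV_iff:
  "f \<in> scott_maps A (sets_order UNIV) \<longleftrightarrow>
    f \<in> extensional (carrier A) \<and> (\<forall>i. (\<lambda>x\<in>carrier A. i \<in> f x) \<in> scott_maps A two)"
    (is "?L \<longleftrightarrow> _ \<and> (\<forall>i. ?p i \<in> _)")
proof -
  have eq: "?p i s = (i \<in> f s)" "(\<exists>x\<in>S. ?p i x) = (\<exists>x\<in>S. i \<in> f x)"
    if "directed A S" "is_sup A s S" for S s i
    using that directed_subset[OF that(1)] by (auto simp: is_sup_iff subset_iff)
  show ?thesis
  proof (intro iffI conjI allI)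
    assume f: ?L
    then show "f \<in> extensional (carrier A)"
      by (rule scott_maps_extensional)
    fix i
    have sup: "?p i s = (\<exists>x\<in>S. ?p i x)" if "directed A S" "is_sup A s S" for S s
    proof -
      have "f s = \<Union>(f ` S)"
        using f that unfolding scott_sets_order_iff[OF union_closed_UNIV] by blast
      then show ?thesis
        unfolding eq[OF that] by simp
    qed
    have mono: "?p i y" if "x \<in> carrier A" "y \<in> carrier A" "x \<sqsubseteq>\<^bsub>A\<^esub> y" "?p i x" for x y
      using scott_maps_mono[OF f that(1-3)] that by auto
    show "?p i \<in> scott_maps A two"
      by (rule scott_twoI[OF restrict_extensional mono sup])
  next
    assume p: "f \<in> extensional (carrier A) \<and> (\<forall>i. ?p i \<in> scott_maps A two)"
    have "i \<in> f y" if "x \<in> carrier A" "y \<in> carrier A" "x \<sqsubseteq>\<^bsub>A\<^esub> y" "i \<in> f x" for x y i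
    proof -
      have "?p i x \<longrightarrow> ?p i y"
        using p that(1-3) unfolding scott_two_iff by blast
      then show ?thesis
        using that by simp
    qed
    moreover have "f s = \<Union>(f ` S)" if "directed A S" "is_sup A s S" for S s
    proof -
      have "?p i s = (\<exists>x\<in>S. ?p i x)" for i
        by (rule scott_two_sup[OF spec[OF conjunct2[OF p]] that])
      then show ?thesis
        unfolding eq[OF that] by auto
    qed
    ultimately show ?L
      using p unfolding scott_sets_order_iff[OF union_closed_UNIV] by auto
  qed
qed

text \<open>Orthogonality passes to powers: both the extension and the comparison are obtained one
  coordinate at a time.\<close>

lemma orthogonal_sets_order:
  assumes e: "e \<in> scott_maps A B" and two: "orthogonal A B e two"
  shows "orthogonal A B e (sets_order UNIV)"
  unfolding orthogonal_def
proof (intro conjI ballI impI)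
  fix f :: "_ \<Rightarrow> 'c set" assume f: "f \<in> scott_maps A (sets_order UNIV)"
  have "\<exists>q. q \<in> scott_maps B two \<and> (\<lambda>x\<in>carrier A. i \<in> f x) = compose (carrier A) q e" for i
    using f orthogonal_ex[OF two] unfolding scott_sets_order_UNIV_iff by metis
  then obtain q where q: "\<And>i. q i \<in> scott_maps B two"
      "\<And>i. (\<lambda>x\<in>carrier A. i \<in> f x) = compose (carrier A) (q i) e"
    by metis
  define g where "g = (\<lambda>b\<in>carrier B. {i. q i b})"
  \<comment> \<open>Off the carrier both sides are \<open>undefined\<close>, because
    \<open>q i\<close> is extensional, so the coordinate of \<open>g\<close> really is the map
    \<open>q i\<close>.\<close>
  have "(\<lambda>b\<in>carrier B. i \<in> g b) = q i" for i
    using scott_maps_extensional[OF q(1)[of i]] by (auto simp: g_def extensional_def fun_eq_iff)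
  then have g: "g \<in> scott_maps B (sets_order UNIV)"
    unfolding scott_sets_order_UNIV_iff using q(1) by (simp add: g_def)
  moreover have "f = compose (carrier A) g e"
  proof (rule scott_maps_eqI[OF f compose_scott_maps[OF e g]])
    fix a assume a: "a \<in> carrier A"
    then have "(i \<in> f a) = q i (e a)" for i
      using q(2)[of i] by (metis (no_types, lifting) compose_eq restrict_apply')
    then show "f a = compose (carrier A) g e a"
      using a scott_maps_closed[OF e] by (auto simp: compose_eq g_def)
  qed
  ultimately show "\<exists>g\<in>scott_maps B (sets_order UNIV). f = compose (carrier A) g e"
    by blast
next
  fix g h :: "_ \<Rightarrow> 'c set" and b
  assume g: "g \<in> scott_maps B (sets_order UNIV)" and h: "h \<in> scott_maps B (sets_order UNIV)"
    and le: "\<forall>a\<in>carrier A. g (e a) \<sqsubseteq>\<^bsub>sets_order UNIV\<^esub> h (e a)" and b: "b \<in> carrier B"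
  have "(\<lambda>x\<in>carrier B. i \<in> g x) b \<sqsubseteq>\<^bsub>two\<^esub> (\<lambda>x\<in>carrier B. i \<in> h x) b" for i
  proof (rule orthogonal_le[OF two _ _ _ b])
    show "(\<lambda>x\<in>carrier B. i \<in> g x) \<in> scott_maps B two" "(\<lambda>x\<in>carrier B. i \<in> h x) \<in> scott_maps B two"
      using g h unfolding scott_sets_order_UNIV_iff by auto
  qed (use le scott_maps_closed[OF e] in \<open>auto simp: two_def\<close>)
  then show "g b \<sqsubseteq>\<^bsub>sets_order UNIV\<^esub> h b"
    using b by (auto simp: two_def)
qed

section \<open>The embedding of a dcpo into a power of \<open>two\<close>\<close>

lemma not_below_scott:
  assumes A: "partial_order A" and y: "y \<in> carrier A"
  shows "(\<lambda>x\<in>carrier A. \<not> x \<sqsubseteq>\<^bsub>A\<^esub> y) \<in> scott_maps A two"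
proof -
  \<comment> \<open>A supremum lies below \<open>y\<close> exactly when all members do, so the
    complement of the principal down-set of \<open>y\<close> is Scott open.\<close>
  have below: "(s \<sqsubseteq>\<^bsub>A\<^esub> y) = (\<forall>x\<in>S. x \<sqsubseteq>\<^bsub>A\<^esub> y)" "s \<in> carrier A"
    if "directed A S" "is_sup A s S" for S s
  proof -
    have S: "S \<subseteq> carrier A"
      using that(1) by (rule directed_subset)
    then have s: "s \<in> carrier A" "\<forall>x\<in>S. x \<sqsubseteq>\<^bsub>A\<^esub> s"
      "\<forall>u\<in>carrier A. (\<forall>x\<in>S. x \<sqsubseteq>\<^bsub>A\<^esub> u) \<longrightarrow> s \<sqsubseteq>\<^bsub>A\<^esub> u"
      using that(2) by (simp_all add: is_sup_iff)
    show "s \<in> carrier A" by (rule s)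
    show "(s \<sqsubseteq>\<^bsub>A\<^esub> y) = (\<forall>x\<in>S. x \<sqsubseteq>\<^bsub>A\<^esub> y)"
      using S s y trans_le[OF A] by blast
  qed
  have "(\<lambda>x\<in>carrier A. \<not> x \<sqsubseteq>\<^bsub>A\<^esub> y) s = (\<exists>x\<in>S. (\<lambda>x\<in>carrier A. \<not> x \<sqsubseteq>\<^bsub>A\<^esub> y) x)"
    if "directed A S" "is_sup A s S" for S s
    using below[OF that] directed_subset[OF that(1)] by (auto simp: subset_iff)
  then show ?thesis
    unfolding scott_two_iff by (auto intro: trans_le[OF A] simp: y)
qed

text \<open>The canonical map into a power of \<open>two\<close>: a point goes to the collection of
  its open neighbourhoods, given by their indicators.\<close>

definition points :: "'u gorder \<Rightarrow> 'u \<Rightarrow> ('u \<Rightarrow> bool) set" where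
  "points X = (\<lambda>x\<in>carrier X. {p \<in> scott_maps X two. p x})"

text \<open>The order is reflected because the open complement of the down-set of \<open>y\<close>
  omits \<open>y\<close>, and so must omit \<open>x\<close>.\<close>

lemma points_le_iff:
  assumes X: "partial_order X" and xy: "x \<in> carrier X" "y \<in> carrier X"
  shows "points X x \<subseteq> points X y \<longleftrightarrow> x \<sqsubseteq>\<^bsub>X\<^esub> y"
proof
  assume "points X x \<subseteq> points X y"
  then have "(\<lambda>z\<in>carrier X. \<not> z \<sqsubseteq>\<^bsub>X\<^esub> y) x \<longrightarrow> (\<lambda>z\<in>carrier X. \<not> z \<sqsubseteq>\<^bsub>X\<^esub> y) y"
    using not_below_scott[OF X xy(2)] xy by (auto simp: points_def)
  then show "x \<sqsubseteq>\<^bsub>X\<^esub> y"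
    using xy X by (simp add: refl_le)
next
  assume "x \<sqsubseteq>\<^bsub>X\<^esub> y"
  then show "points X x \<subseteq> points X y"
    using xy by (auto simp: points_def scott_two_iff)
qed

lemma points_scott: "points X \<in> scott_maps X (sets_order UNIV)"
proof -
  \<comment> \<open>The index type contains all functions, so coordinates at maps \<open>p\<close>
    that are not continuous occur too; these are constantly false.\<close>
  have "(\<lambda>x\<in>carrier X. p \<in> points X x) = (if p \<in> scott_maps X two then p else (\<lambda>x\<in>carrier X. False))"
    for p
    by (auto simp: points_def fun_eq_iff scott_two_iff extensional_def)
  moreover have "(\<lambda>x\<in>carrier X. False) \<in> scott_maps X two"
    by (rule const_scott[OF partial_order_two]) (simp add: two_def)
  ultimately show ?thesis
    unfolding scott_sets_order_UNIV_iff by (auto simp: points_def)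
qed

lemma scott_maps_subsets:
  assumes "union_closed M" "f \<in> scott_maps A (sets_order UNIV)" "\<And>a. a \<in> carrier A \<Longrightarrow> f a \<in> M"
  shows "f \<in> scott_maps A (sets_order M)"
  using assms by (simp add: scott_sets_order_iff union_closed_UNIV)

lemma scott_maps_subsets_UNIV:
  assumes "union_closed M" "f \<in> scott_maps A (sets_order M)"
  shows "f \<in> scott_maps A (sets_order UNIV)"
  using assms by (simp add: scott_sets_order_iff union_closed_UNIV)

text \<open>An order embedding reflects suprema, so continuity of a map into \<open>C\<close> can be
  tested after composing it with \<open>points C\<close>.\<close>

lemma scott_maps_via_points:
  assumes C: "partial_order C" and f: "f \<in> extensional (carrier A)" "\<And>a. a \<in> carrier A \<Longrightarrow> f a \<in> carrier C"
    and pf: "(\<lambda>a\<in>carrier A. points C (f a)) \<in> scott_maps A (sets_order UNIV)"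
  shows "f \<in> scott_maps A C"
proof (rule scott_mapsI[OF f])
  let ?h = "\<lambda>a\<in>carrier A. points C (f a)"
  show mono: "f x \<sqsubseteq>\<^bsub>C\<^esub> f y" if "x \<in> carrier A" "y \<in> carrier A" "x \<sqsubseteq>\<^bsub>A\<^esub> y" for x y
    using scott_maps_mono[OF pf that] that f(2) by (simp add: points_le_iff[OF C])
  fix S s
  assume S: "directed A S" and s: "is_sup A s S"
  have SA: "S \<subseteq> carrier A" and sA: "s \<in> carrier A" and ub: "\<forall>x\<in>S. x \<sqsubseteq>\<^bsub>A\<^esub> s"
    using s directed_subset[OF S] by (auto simp: is_sup_iff)
  have "?h s = \<Union>(?h ` S)"
    using pf S s unfolding scott_sets_order_iff[OF union_closed_UNIV] by blast
  then have eq: "points C (f s) = (\<Union>x\<in>S. points C (f x))"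
    using SA sA by (auto simp: subset_iff)
  have "f ` S \<subseteq> carrier C"
    using SA f(2) by blast
  moreover have "f s \<sqsubseteq>\<^bsub>C\<^esub> u" if u: "u \<in> carrier C" "\<forall>x\<in>S. f x \<sqsubseteq>\<^bsub>C\<^esub> u" for u
  proof -
    have "points C (f x) \<subseteq> points C u" if "x \<in> S" for x
      using that u SA f(2) by (subst points_le_iff[OF C]) auto
    then have "points C (f s) \<subseteq> points C u"
      unfolding eq by blast
    then show ?thesis
      using points_le_iff[OF C] f(2) sA u by blast
  qed
  ultimately show "is_sup C (f s) (f ` S)"
    using mono SA sA ub f(2) by (auto simp: is_sup_iff subset_iff)
qed

section \<open>The reflection\<close>

text \<open>
  \<open>hull (points X ` carrier X)\<close> is the least sub-dcpo of a power of \<open>two\<close> that lies in \<open>R2\<close>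
  (up to transport to the type \<open>'u\<close>) and contains the image of \<open>X\<close>.
\<close>

inductive_set hull :: "('u \<Rightarrow> bool) set set \<Rightarrow> ('u \<Rightarrow> bool) set set"
  for N :: "('u \<Rightarrow> bool) set set" where
  base: "F \<in> N \<Longrightarrow> F \<in> hull N"
| Union: "\<lbrakk>S \<noteq> {}; \<And>F. F \<in> S \<Longrightarrow> F \<in> hull N; \<And>F G. F \<in> S \<Longrightarrow> G \<in> S \<Longrightarrow> \<exists>H\<in>S. F \<subseteq> H \<and> G \<subseteq> H\<rbrakk>
    \<Longrightarrow> \<Union>S \<in> hull N"
| extend: "\<lbrakk>A \<in> (DCPO :: 'u gorder set); B \<in> (DCPO :: 'u gorder set); e \<in> E2 A B;
      g \<in> scott_maps B (sets_order UNIV); \<And>a. a \<in> carrier A \<Longrightarrow> g (e a) \<in> hull N; b \<in> carrier B\<rbrakk>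
    \<Longrightarrow> g b \<in> hull N"

lemma union_closed_hull: "union_closed (hull N)"
  unfolding union_closed_def
proof (intro allI impI)
  fix S assume "directed (sets_order (hull N)) S"
  then show "\<Union>S \<in> hull N"
    unfolding directed_def by (intro hull.Union) auto
qed

text \<open>A map into the hull extends into the whole power, and the rule \<open>extend\<close>
  keeps the values of this extension in the hull. Order reflection is inherited from the
  power.\<close>

lemma orthogonal_hull:
  fixes A B :: "'u gorder" and N :: "('u \<Rightarrow> bool) set set"
  assumes A: "A \<in> DCPO" and B: "B \<in> DCPO" and e: "e \<in> E2 A B"
  shows "orthogonal A B e (sets_order (hull N))"
proof -
  have o: "orthogonal A B e (sets_order (UNIV :: ('u \<Rightarrow> bool) set set))"
    using e by (auto simp: E2_iff orthogonal_sets_order)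
  show ?thesis
    unfolding orthogonal_def
  proof (intro conjI ballI impI)
    fix f assume f: "f \<in> scott_maps A (sets_order (hull N))"
    obtain g where g: "g \<in> scott_maps B (sets_order UNIV)" "f = compose (carrier A) g e"
      using orthogonal_ex[OF o scott_maps_subsets_UNIV[OF union_closed_hull f]] .
    have "g (e a) \<in> hull N" if "a \<in> carrier A" for a
      using compose_eqD[OF g(2) that] scott_maps_closed[OF f that] by simp
    then have "g b \<in> hull N" if "b \<in> carrier B" for b
      using that by (rule hull.extend[OF A B e g(1)])
    then have "g \<in> scott_maps B (sets_order (hull N))"
      by (rule scott_maps_subsets[OF union_closed_hull g(1)])
    then show "\<exists>g\<in>scott_maps B (sets_order (hull N)). f = compose (carrier A) g e"
      using g(2) by blast
  next
    fix g h b
    assume g: "g \<in> scott_maps B (sets_order (hull N))" and h: "h \<in> scott_maps B (sets_order (hull N))"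
      and le: "\<forall>a\<in>carrier A. g (e a) \<sqsubseteq>\<^bsub>sets_order (hull N)\<^esub> h (e a)" and b: "b \<in> carrier B"
    note UNIV = scott_maps_subsets_UNIV[OF union_closed_hull]
    show "g b \<sqsubseteq>\<^bsub>sets_order (hull N)\<^esub> h b"
      using orthogonal_le[OF o UNIV[OF g] UNIV[OF h] _ b] le by simp
  qed
qed

text \<open>The generators are dense as seen from \<open>R2\<close>: the set where \<open>g\<close>
  lies below \<open>h\<close> is closed under directed unions by continuity, and under the rule
  \<open>extend\<close> by orthogonality of \<open>C\<close>. This yields uniqueness of
  extensions.\<close>

lemma hull_le:
  fixes C :: "'u gorder" and N :: "('u \<Rightarrow> bool) set set"
  assumes C: "C \<in> R2" and g: "g \<in> scott_maps (sets_order (hull N)) C"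
    and h: "h \<in> scott_maps (sets_order (hull N)) C"
    and N: "\<And>F. F \<in> N \<Longrightarrow> g F \<sqsubseteq>\<^bsub>C\<^esub> h F" and F: "F \<in> hull N"
  shows "g F \<sqsubseteq>\<^bsub>C\<^esub> h F"
  using F
proof induction
  case (Union S)
  let ?H = "sets_order (hull N)"
  have S: "directed ?H S"
    using Union unfolding directed_def by auto
  then have sup: "is_sup ?H (\<Union>S) S"
    using is_sup_sets_order[OF union_closed_hull] by blast
  have pC: "partial_order C"
    using C R2_iff DCPO_partial_order by blast
  have US: "\<Union>S \<in> hull N"
    using sup S directed_subset[OF S] by (simp add: is_sup_iff)
  have "g F \<sqsubseteq>\<^bsub>C\<^esub> h (\<Union>S)" if "F \<in> S" for F
  proof -
    have "h F \<sqsubseteq>\<^bsub>C\<^esub> h (\<Union>S)"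
      using that US Union(2) by (intro scott_maps_mono[OF h]) auto
    moreover have "g F \<in> carrier C" "h F \<in> carrier C" "h (\<Union>S) \<in> carrier C"
      using Union(2)[OF that] US scott_maps_closed[OF g] scott_maps_closed[OF h] by auto
    ultimately show ?thesis
      using Union(4)[OF that] by (blast intro: trans_le[OF pC])
  qed
  then show ?case
    using scott_maps_sup[OF g S sup] directed_subset[OF directed_image[OF g S]]
      scott_maps_closed[OF h, of "\<Union>S"] US by (simp add: is_sup_iff)
next
  case (extend A B e f b)
  have e: "e \<in> scott_maps A B" and o: "orthogonal A B e C"
    using extend(3) R2_orthogonal[OF C extend(1-3)] by (auto simp: E2_iff)
  have "f x \<in> hull N" if "x \<in> carrier B" for x
    by (rule hull.extend[OF extend(1-5) that])
  then have f: "f \<in> scott_maps B (sets_order (hull N))"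
    using scott_maps_subsets[OF union_closed_hull] extend(4) by blast
  \<comment> \<open>Along \<open>e\<close> the comparison is the induction hypothesis; order
    reflection spreads it over all of \<open>B\<close>.\<close>
  have "compose (carrier B) g f b \<sqsubseteq>\<^bsub>C\<^esub> compose (carrier B) h f b"
    by (rule orthogonal_le[OF o compose_scott_maps[OF f g] compose_scott_maps[OF f h] _ extend(6)])
      (use extend scott_maps_closed[OF e] in \<open>simp add: compose_eq\<close>)
  then show ?case
    using extend(6) by (simp add: compose_eq)
qed (rule N)

text \<open>The map \<open>f\<close> induces a map \<open>T\<close> between the powers that contain
  \<open>X\<close> and \<open>C\<close>. The preimage under \<open>T\<close> of the embedded copy of
  \<open>C\<close> contains the generators and is closed under both other rules, since
  \<open>C\<close> is a dcpo in \<open>R2\<close>. So \<open>T\<close> sends the hull into that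
  copy, and the inverse \<open>r\<close> of \<open>points C\<close> returns elements of
  \<open>C\<close>.\<close>

lemma hull_extension:
  fixes X C :: "'u gorder"
  assumes C: "C \<in> R2" and f: "f \<in> scott_maps X C"
  obtains g where "g \<in> scott_maps (sets_order (hull (points X ` carrier X))) C"
    "\<And>x. x \<in> carrier X \<Longrightarrow> g (points X x) = f x"
proof -
  let ?N = "points X ` carrier X" and ?W = "sets_order (UNIV :: ('u \<Rightarrow> bool) set set)"
  \<comment> \<open>Reindexing along precomposition with \<open>f\<close>. It satisfies
    \<open>T (points X x) = points C (f x)\<close> and commutes with all unions.\<close>
  define T where "T F = {p \<in> scott_maps C two. compose (carrier X) p f \<in> F}" for F
  have dC: "dcpo C" and pC: "partial_order C"
    using C by (auto simp: R2_iff DCPO_def dcpo_partial_order)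
  have T_points: "T (points X x) = points C (f x)" if "x \<in> carrier X" for x
    using that scott_maps_closed[OF f that] compose_scott_maps[OF f]
    by (auto simp: T_def points_def compose_eq)
  have T_Union: "T (\<Union>S) = \<Union>(T ` S)" for S
    by (auto simp: T_def)
  have T_mono: "F \<subseteq> G \<Longrightarrow> T F \<subseteq> T G" for F G
    by (auto simp: T_def)
  have T_compose: "(\<lambda>b\<in>carrier B. T (h b)) \<in> scott_maps B ?W" if h: "h \<in> scott_maps B ?W"
    for B :: "'b gorder" and h
  proof -
    have "(\<lambda>b\<in>carrier B. T (h b)) s = \<Union>((\<lambda>b\<in>carrier B. T (h b)) ` S)"
      if "directed B S" "is_sup B s S" for S s
    proof -
      have "S \<subseteq> carrier B" "s \<in> carrier B"
          using that directed_subset[OF that(1)] by (simp_all add: is_sup_iff)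
      moreover have "h s = \<Union>(h ` S)"
        using h that unfolding scott_sets_order_iff[OF union_closed_UNIV] by blast
      ultimately show ?thesis
        by (auto simp: T_Union subset_iff)
    qed
    then show ?thesis
      using h T_mono unfolding scott_sets_order_iff[OF union_closed_UNIV] by simp
  qed
  define r where "r = inv_into (carrier C) (points C)"
  have r: "r F \<in> carrier C" "points C (r F) = F" if "F \<in> points C ` carrier C" for F
    using that by (auto simp: r_def inv_into_into f_inv_into_f)
  have r_points: "r (points C c) = c" if "c \<in> carrier C" for c
    using r[of "points C c"] that antisym_le[OF pC] points_le_iff[OF pC] by blast
  have TF: "T F \<in> points C ` carrier C" if "F \<in> hull ?N" for F
    using that
  proof induction
    case (base F)
    then show ?case
      using T_points scott_maps_closed[OF f] by auto
  next
    case (Union S)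
    \<comment> \<open>Taking \<open>S\<close> as its own carrier restricts the monotonicity check to
      members of \<open>S\<close>, where the induction hypothesis is available.\<close>
    have "directed (sets_order S) S"
      using Union by (auto simp: directed_def)
    then have "directed C ((\<lambda>F. r (T F)) ` S)"
      by (rule directed_mono_image[rotated 2])
        (auto simp: r[OF Union(4)] T_mono simp flip: points_le_iff[OF pC])
    moreover from this obtain s where s: "is_sup C s ((\<lambda>F. r (T F)) ` S)"
      using dC dcpo_def by blast
    ultimately have "points C s = \<Union>(points C ` (\<lambda>F. r (T F)) ` S)" "s \<in> carrier C"
      using points_scott[of C] unfolding scott_sets_order_iff[OF union_closed_UNIV]
      by (blast, simp add: is_sup_iff directed_subset)
    moreover have "\<Union>(points C ` (\<lambda>F. r (T F)) ` S) = \<Union>(T ` S)"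
      by (simp add: image_image r(2)[OF Union(4)] cong: image_cong)
    ultimately show ?case
      unfolding T_Union by (metis imageI)
  next
    case (extend A B e h b)
    have e: "e \<in> scott_maps A B" and oC: "orthogonal A B e C" and oW: "orthogonal A B e ?W"
      using extend(3) R2_orthogonal[OF C extend(1-3)] by (auto simp: E2_iff orthogonal_sets_order)
    have he: "compose (carrier A) h e \<in> scott_maps A ?W"
      using e extend(4) by (rule compose_scott_maps)
    \<comment> \<open>The map \<open>T\<close> after \<open>h\<close> after \<open>e\<close>, read
      in \<open>C\<close>: by the induction hypothesis its values lie in the embedded copy. It then
      extends along \<open>e\<close> to some \<open>q\<close>.\<close>
    let ?k = "\<lambda>a\<in>carrier A. r (T (h (e a)))"
    have "(\<lambda>a\<in>carrier A. points C (?k a)) = (\<lambda>a\<in>carrier A. T (compose (carrier A) h e a))"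
      by (auto simp: fun_eq_iff compose_eq r(2)[OF extend(7)])
    then have "?k \<in> scott_maps A C"
      using T_compose[OF he] by (intro scott_maps_via_points[OF pC]) (auto simp: r(1)[OF extend(7)])
    then obtain q where q: "q \<in> scott_maps B C" "?k = compose (carrier A) q e"
      using orthogonal_ex[OF oC] by blast
    \<comment> \<open>Both maps go into the full power and agree along \<open>e\<close>, so
      uniqueness there makes \<open>T (h b)\<close> the image of \<open>q b\<close>.\<close>
    have "compose (carrier B) (points C) q b = (\<lambda>b\<in>carrier B. T (h b)) b"
    proof (rule orthogonal_eq[OF partial_order_sets_order e oW _ _ _ extend(6)])
      show "compose (carrier B) (points C) q \<in> scott_maps B ?W"
        using q(1) points_scott by (rule compose_scott_maps)
      show "(\<lambda>b\<in>carrier B. T (h b)) \<in> scott_maps B ?W"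
        using extend(4) by (rule T_compose)
      fix a assume a: "a \<in> carrier A"
      have "q (e a) = r (T (h (e a)))"
        using compose_eqD[OF q(2) a] a by simp
      then show "compose (carrier B) (points C) q (e a) = (\<lambda>b\<in>carrier B. T (h b)) (e a)"
        using a scott_maps_closed[OF e] by (simp add: compose_eq r(2)[OF extend(7)])
    qed
    then have "points C (q b) = T (h b)"
      using extend(6) by (simp add: compose_eq)
    then show ?case
      using scott_maps_closed[OF q(1) extend(6)] by (metis imageI)
  qed
  let ?g = "\<lambda>F\<in>hull ?N. r (T F)"
  have id: "id_map (sets_order (hull ?N)) \<in> scott_maps (sets_order (hull ?N)) ?W"
    using scott_maps_subsets_UNIV[OF union_closed_hull id_map_scott] .
  have "(\<lambda>F\<in>hull ?N. points C (?g F)) = (\<lambda>F\<in>hull ?N. T (id_map (sets_order (hull ?N)) F))"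
    by (auto simp: fun_eq_iff id_map_def r(2)[OF TF])
  then have "?g \<in> scott_maps (sets_order (hull ?N)) C"
    using T_compose[OF id] by (intro scott_maps_via_points[OF pC]) (auto simp: r(1)[OF TF])
  moreover have "?g (points X x) = f x" if "x \<in> carrier X" for x
    using that T_points r_points scott_maps_closed[OF f] by (simp add: hull.base)
  ultimately show thesis
    by (rule that)
qed

section \<open>Smallness of the hull\<close>

lemma hull_subset_Pow:
  assumes N: "N \<subseteq> Pow Q"
  shows "hull N \<subseteq> Pow Q"
proof
  fix F assume "F \<in> hull N"
  then show "F \<in> Pow Q"
  proof induction
    case (extend A B e g b)
    have o: "orthogonal A B e (sets_order UNIV)"
      using extend(3) by (auto simp: E2_iff orthogonal_sets_order)
    have e: "e \<in> scott_maps A B"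
      using extend(3) by (simp add: E2_iff)
    \<comment> \<open>Along \<open>e\<close> the map \<open>g\<close> lies below the constant map
      \<open>Q\<close>, hence it does so everywhere by order reflection.\<close>
    have "g b \<sqsubseteq>\<^bsub>sets_order UNIV\<^esub> (\<lambda>b\<in>carrier B. Q) b"
      by (rule orthogonal_le[OF o extend(4) const_scott[OF partial_order_sets_order] _ extend(6)])
        (use extend(7) scott_maps_closed[OF e] in auto)
    then show ?case
      using extend(6) by simp
  qed (use N in auto)
qed

text \<open>\<open>strong_limit\<close> speaks of subsets of \<open>'u\<close> only; an injection
  carries it over to small sets of any type.\<close>

lemma lesspoll_Pow:
  fixes A :: "'a set"
  assumes lim: "strong_limit TYPE('u)" and A: "A \<prec> (UNIV :: 'u set)"
  shows "Pow A \<prec> (UNIV :: 'u set)"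
proof -
  obtain f :: "'a \<Rightarrow> 'u" where f: "inj_on f A"
    using A by (auto simp: lesspoll_def lepoll_def)
  then have "Pow (f ` A) \<prec> (UNIV :: 'u set)"
    using lim A by (simp add: strong_limit_def)
  moreover have "Pow A \<approx> Pow (f ` A)"
    using f bij_betw_Pow[OF inj_on_imp_bij_betw[OF f]] by (auto simp: eqpoll_def)
  ultimately show ?thesis
    by (rule eq_lesspoll_trans[rotated])
qed

text \<open>Two power sets suffice: an extensional map to \<open>two\<close> is determined by the
  set where it holds, and members of the hull are sets of such maps.\<close>

lemma lesspoll_hull:
  fixes X :: "'u gorder"
  assumes lim: "strong_limit TYPE('u)" and X: "X \<in> DCPO"
  shows "hull (points X ` carrier X) \<prec> (UNIV :: 'u set)"
proof -
  have "inj_on (\<lambda>p. {x \<in> carrier X. p x}) (scott_maps X two)"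
    by (intro inj_onI) (auto intro!: scott_maps_eqI)
  then have "scott_maps X two \<lesssim> Pow (carrier X)"
    by (force simp: lepoll_def)
  also have "Pow (carrier X) \<prec> (UNIV :: 'u set)"
    using X by (intro lesspoll_Pow[OF lim]) (simp add: DCPO_def)
  finally have "Pow (scott_maps X two) \<prec> (UNIV :: 'u set)"
    by (rule lesspoll_Pow[OF lim])
  moreover have "hull (points X ` carrier X) \<subseteq> Pow (scott_maps X two)"
    by (rule hull_subset_Pow) (auto simp: points_def)
  ultimately show ?thesis
    by (meson lesspoll_trans1 subset_imp_lepoll)
qed

text \<open>The reflection is a copy \<open>L\<close> of the hull on \<open>'u\<close>, with
  \<open>points X\<close> as unit up to this copy. Existence is \<open>hull_extension\<close>;
  uniqueness applies \<open>hull_le\<close> in both directions, then antisymmetry.\<close>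

lemma R2_reflection:
  fixes X :: "'u gorder"
  assumes lim: "strong_limit TYPE('u)" and X: "X \<in> DCPO"
  shows "\<exists>L\<in>(R2 :: 'u gorder set). \<exists>\<kappa>\<in>scott_maps X L. \<forall>C\<in>(R2 :: 'u gorder set). \<forall>f\<in>scott_maps X C.
    \<exists>!g. g \<in> scott_maps L C \<and> f = compose (carrier X) g \<kappa>"
proof -
  define N where "N = points X ` carrier X"
  let ?H = "sets_order (hull N)"
  have "dcpo ?H"
    by (rule dcpo_sets_order[OF union_closed_hull])
  then obtain L :: "'u gorder" and i where L: "L \<in> DCPO" and i: "dcpo_iso ?H L i"
    using dcpo_transport[of ?H, where 'u = 'u] lesspoll_hull[OF lim X] unfolding N_def by auto
  have "L \<in> R2"
    by (rule R2_transport[OF orthogonal_hull L i])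
  obtain j where i1: "i \<in> scott_maps ?H L" and j: "j \<in> scott_maps L ?H"
    and ji: "\<And>F. F \<in> hull N \<Longrightarrow> j (i F) = F" and ij: "\<And>y. y \<in> carrier L \<Longrightarrow> i (j y) = y"
    using i by (elim dcpo_isoE) auto
  have pt: "points X \<in> scott_maps X ?H"
    by (rule scott_maps_subsets[OF union_closed_hull points_scott]) (simp add: N_def hull.base)
  let ?\<kappa> = "compose (carrier X) i (points X)"
  have \<kappa>: "?\<kappa> \<in> scott_maps X L"
    using pt i1 by (rule compose_scott_maps)
  have ex1: "\<exists>!g. g \<in> scott_maps L C \<and> f = compose (carrier X) g ?\<kappa>"
    if C: "C \<in> R2" and f: "f \<in> scott_maps X C" for C :: "'u gorder" and f
  proof (rule ex_ex1I)
    obtain g where g: "g \<in> scott_maps ?H C" "\<And>x. x \<in> carrier X \<Longrightarrow> g (points X x) = f x"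
      using hull_extension[OF C f] unfolding N_def by blast
    have gj: "compose (carrier L) g j \<in> scott_maps L C"
      using j g(1) by (rule compose_scott_maps)
    have "f = compose (carrier X) (compose (carrier L) g j) ?\<kappa>"
    proof (rule scott_maps_eqI[OF f compose_scott_maps[OF \<kappa> gj]])
      fix x assume x: "x \<in> carrier X"
      then have "points X x \<in> hull N"
        using scott_maps_closed[OF pt] by simp
      then show "f x = compose (carrier X) (compose (carrier L) g j) ?\<kappa> x"
        using x g(2) ji scott_maps_closed[OF i1] by (simp add: compose_eq)
    qed
    then show "\<exists>g. g \<in> scott_maps L C \<and> f = compose (carrier X) g ?\<kappa>"
      using gj by blast
  next
    have pC: "partial_order C"
      using C R2_iff DCPO_partial_order by blast
    have le: "g y \<sqsubseteq>\<^bsub>C\<^esub> h y" if g: "g \<in> scott_maps L C" "f = compose (carrier X) g ?\<kappa>"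
      and h: "h \<in> scott_maps L C" "f = compose (carrier X) h ?\<kappa>" and y: "y \<in> carrier L" for g h y
    proof -
      have jy: "j y \<in> hull N"
        using scott_maps_closed[OF j y] by simp
      have "compose (hull N) g i (j y) \<sqsubseteq>\<^bsub>C\<^esub> compose (hull N) h i (j y)"
      proof (rule hull_le[OF C _ _ _ jy])
        show "compose (hull N) g i \<in> scott_maps ?H C" "compose (hull N) h i \<in> scott_maps ?H C"
          using compose_scott_maps[OF i1] g h by fastforce+
        fix F assume "F \<in> N"
        then obtain x where x: "x \<in> carrier X" "F = points X x"
          unfolding N_def by blast
        have "g (?\<kappa> x) = f x" "h (?\<kappa> x) = f x"
          using compose_eqD[OF g(2) x(1)] compose_eqD[OF h(2) x(1)] by auto
        then show "compose (hull N) g i F \<sqsubseteq>\<^bsub>C\<^esub> compose (hull N) h i F"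
          using x scott_maps_closed[OF pt x(1)] scott_maps_closed[OF f x(1)] refl_le[OF pC]
          by (simp add: compose_eq)
      qed
      then show ?thesis
        using jy ij y by (simp add: compose_eq)
    qed
    fix g h
    assume g: "g \<in> scott_maps L C \<and> f = compose (carrier X) g ?\<kappa>"
      and h: "h \<in> scott_maps L C \<and> f = compose (carrier X) h ?\<kappa>"
    show "g = h"
    proof (rule scott_maps_eqI)
      show "g \<in> scott_maps L C" "h \<in> scott_maps L C"
        using g h by auto
      fix y assume y: "y \<in> carrier L"
      show "g y = h y"
      proof (rule antisym_le[OF pC])
        show "g y \<sqsubseteq>\<^bsub>C\<^esub> h y"
          by (rule le[of g h y]) (use g h y in blast)+
        show "h y \<sqsubseteq>\<^bsub>C\<^esub> g y"
          by (rule le[of h g y]) (use g h y in blast)+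
        show "g y \<in> carrier C" "h y \<in> carrier C"
          using scott_maps_closed[OF conjunct1[OF g] y] scott_maps_closed[OF conjunct1[OF h] y] .
      qed
    qed
  qed
  show ?thesis
    by (rule bexI[OF _ \<open>L \<in> R2\<close>], rule bexI[OF _ \<kappa>]) (intro ballI ex1)
qed

section \<open>Minimality\<close>

lemma ex_two_in_R2:
  assumes lim: "strong_limit TYPE('u)"
  obtains T :: "'u gorder" and i where "T \<in> R2" "dcpo_iso two T i"
proof -
  \<comment> \<open>Types are nonempty, so the empty set is small; two power sets above it there are
    two elements, enough for a copy of \<open>two\<close>.\<close>
  have "({} :: 'u set) \<prec> (UNIV :: 'u set)"
    by (simp add: lesspoll_def lepoll_def eqpoll_def bij_betw_def)
  then have "Pow (Pow ({} :: 'u set)) \<prec> (UNIV :: 'u set)"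
    by (intro lesspoll_Pow[OF lim])
  moreover have "carrier two \<lesssim> Pow (Pow ({} :: 'u set))"
  proof -
    have "inj_on (\<lambda>b. if b then {{}} else {}) (carrier two)"
      "(\<lambda>b. if b then {{}} else {}) ` carrier two \<subseteq> Pow (Pow ({} :: 'u set))"
      by (auto simp: inj_on_def)
    then show ?thesis
      unfolding lepoll_def by blast
  qed
  ultimately have "carrier two \<prec> (UNIV :: 'u set)"
    by (rule lesspoll_trans1[rotated])
  moreover have "dcpo two"
    using partial_order_two by (auto simp: dcpo_def is_sup_two)
  ultimately obtain T :: "'u gorder" and i where T: "T \<in> DCPO" "dcpo_iso two T i"
    using dcpo_transport by blast
  \<comment> \<open>Orthogonality of \<open>two\<close> to every map in \<open>E2\<close> is what
    \<open>E2\<close> was defined by.\<close>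
  have "T \<in> R2"
    by (rule R2_transport[OF _ T]) (simp add: E2_iff)
  then show thesis
    using T(2) by (rule that)
qed

section \<open>Retracts of objects in a reflective subcategory\<close>

lemma reflective_eq:
  assumes "\<forall>C\<in>K. \<forall>f\<in>scott_maps D C. \<exists>!g. g \<in> scott_maps L C \<and> f = compose (carrier D) g \<kappa>"
    and "\<kappa> \<in> scott_maps D L" "C \<in> K" "g \<in> scott_maps L C" "h \<in> scott_maps L C"
    and "\<And>x. x \<in> carrier D \<Longrightarrow> g (\<kappa> x) = h (\<kappa> x)"
  shows "g = h"
proof -
  have "compose (carrier D) g \<kappa> = compose (carrier D) h \<kappa>"
    using assms(6) by (auto simp: compose_def)
  moreover have "compose (carrier D) g \<kappa> \<in> scott_maps D C"
    using assms by (intro compose_scott_maps)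
  ultimately show ?thesis
    using assms by metis
qed

text \<open>The section \<open>s\<close> factors as \<open>g\<close> after \<open>\<kappa>\<close>,
  so \<open>r\<close> after \<open>g\<close> is a left inverse of \<open>\<kappa>\<close>. It is
  also a right inverse, because \<open>\<kappa>\<close> after it agrees with the identity along
  \<open>\<kappa>\<close>. Thus \<open>T\<close> is isomorphic to its reflection.\<close>

lemma reflective_retract:
  fixes K :: "'u gorder set"
  assumes K: "reflective K" and A: "A \<in> K" and T: "T \<in> DCPO"
    and s: "s \<in> scott_maps T A" and r: "r \<in> scott_maps A T"
    and rs: "\<And>x. x \<in> carrier T \<Longrightarrow> r (s x) = x"
  shows "T \<in> K"
proof -
  obtain L \<kappa> where L: "L \<in> K" and \<kappa>: "\<kappa> \<in> scott_maps T L"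
    and univ: "\<forall>C\<in>K. \<forall>f\<in>scott_maps T C. \<exists>!g. g \<in> scott_maps L C \<and> f = compose (carrier T) g \<kappa>"
    using K T unfolding reflective_def by blast
  have full: "full_subcategory K"
    using K reflective_def by blast
  obtain g where g: "g \<in> scott_maps L A" "s = compose (carrier T) g \<kappa>"
    using univ A s by blast
  let ?k = "compose (carrier L) r g"
  have k: "?k \<in> scott_maps L T"
    using g(1) r by (rule compose_scott_maps)
  have k\<kappa>: "?k (\<kappa> x) = x" if "x \<in> carrier T" for x
    using compose_eqD[OF g(2) that] rs[OF that] scott_maps_closed[OF \<kappa> that] by (simp add: compose_eq)
  have "compose (carrier L) \<kappa> ?k = id_map L"
  proof (rule reflective_eq[OF univ \<kappa> L compose_scott_maps[OF k \<kappa>] id_map_scott])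
    fix x assume "x \<in> carrier T"
    then show "compose (carrier L) \<kappa> ?k (\<kappa> x) = id_map L (\<kappa> x)"
      using k\<kappa> scott_maps_closed[OF \<kappa>] by (simp add: compose_eq id_map_def)
  qed
  moreover have "compose (carrier T) ?k \<kappa> = id_map T"
    by (rule scott_maps_eqI[OF compose_scott_maps[OF \<kappa> k] id_map_scott])
      (metis compose_eq id_map_def k\<kappa> restrict_apply')
  ultimately have "dcpo_iso L T ?k"
    using k \<kappa> unfolding dcpo_iso_def by blast
  then show ?thesis
    using full L T unfolding full_subcategory_def by blast
qed

text \<open>Every nonempty subset of \<open>two\<close> contains its supremum, so monotonicity is
  enough for continuity.\<close>

lemma chain_scott:
  assumes A: "partial_order A" and ab: "a \<in> carrier A" "b \<in> carrier A" "a \<sqsubseteq>\<^bsub>A\<^esub> b"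
  shows "(\<lambda>t. if t then b else a) \<in> scott_maps two A"
proof (rule scott_mapsI)
  fix S s assume S: "directed two S" and s: "is_sup two s S"
  have "S \<noteq> {}" "S \<subseteq> {True, False}"
    using S by (auto simp: directed_def)
  then consider "S = {True}" | "S = {False}" | "S = {True, False}"
    by blast
  then show "is_sup A (if s then b else a) ((\<lambda>t. if t then b else a) ` S)"
    using s ab refl_le[OF A] by cases (simp_all add: is_sup_two is_sup_iff)
qed (use ab refl_le[OF A] in \<open>auto simp: two_def extensional_def\<close>)

lemma nondiscrete_two_in:
  fixes K :: "'u gorder set"
  assumes K: "reflective K" and A: "A \<in> K" "\<not> discrete A"
    and T: "T \<in> DCPO" "dcpo_iso two T i"
  shows "T \<in> K"
proof -
  have pA: "partial_order A"
    using K A(1) DCPO_partial_order unfolding reflective_def full_subcategory_def by blast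
  obtain a b where ab: "a \<in> carrier A" "b \<in> carrier A" "a \<sqsubseteq>\<^bsub>A\<^esub> b" "a \<noteq> b"
    using A(2) unfolding discrete_def by blast
  then have ba: "\<not> b \<sqsubseteq>\<^bsub>A\<^esub> a"
    using antisym_le[OF pA] by blast
  obtain j where i: "i \<in> scott_maps two T" and j: "j \<in> scott_maps T two"
    and ij: "\<And>y. y \<in> carrier T \<Longrightarrow> i (j y) = y"
    using T(2) by (rule dcpo_isoE) blast
  \<comment> \<open>The chain is embedded as \<open>a\<close>, \<open>b\<close>; the indicator of
    the elements not below \<open>a\<close> is false at \<open>a\<close> and true at
    \<open>b\<close>, hence a retraction.\<close>
  let ?s = "\<lambda>t. if t then b else a" and ?r = "\<lambda>x\<in>carrier A. \<not> x \<sqsubseteq>\<^bsub>A\<^esub> a"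
  have rs: "?r (?s t) = t" for t
    using ab ba refl_le[OF pA] by simp
  show ?thesis
  proof (rule reflective_retract[OF K A(1) T(1)])
    show "compose (carrier T) ?s j \<in> scott_maps T A"
      using j chain_scott[OF pA ab(1-3)] by (rule compose_scott_maps)
    show "compose (carrier A) i ?r \<in> scott_maps A T"
      using not_below_scott[OF pA ab(1)] i by (rule compose_scott_maps)
    fix y assume "y \<in> carrier T"
    then show "compose (carrier A) i ?r (compose (carrier T) ?s j y) = y"
      using rs[of "j y"] ij ab by (simp add: compose_eq)
  qed
qed

section \<open>Reflection maps belong to \<open>E2\<close>\<close>

lemma sup_scott_two:
  assumes "g \<in> scott_maps A two" "h \<in> scott_maps A two"
  shows "(\<lambda>x\<in>carrier A. g x \<or> h x) \<in> scott_maps A two"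
proof -
  have "(\<lambda>x\<in>carrier A. g x \<or> h x) s = (\<exists>x\<in>S. (\<lambda>x\<in>carrier A. g x \<or> h x) x)"
    if "directed A S" "is_sup A s S" for S s
  proof -
    have "S \<subseteq> carrier A" "s \<in> carrier A"
      using that directed_subset[OF that(1)] by (simp_all add: is_sup_iff)
    moreover have "g s = (\<exists>x\<in>S. g x)" "h s = (\<exists>x\<in>S. h x)"
      by (rule scott_two_sup[OF assms(1) that], rule scott_two_sup[OF assms(2) that])
    ultimately show ?thesis
      by (auto simp: subset_iff)
  qed
  then show ?thesis
    using assms unfolding scott_two_iff by simp
qed

text \<open>The copy \<open>T\<close> of \<open>two\<close> lies in \<open>K\<close>, so the
  universal property of \<open>\<kappa>\<close> applies to maps into \<open>T\<close>; the
  isomorphism with inverse maps \<open>i\<close> and \<open>j\<close> transfers it to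
  \<open>two\<close>.\<close>

lemma reflection_in_E2:
  assumes T: "T \<in> K" "dcpo_iso two T i" and \<kappa>: "\<kappa> \<in> scott_maps D L"
    and univ: "\<forall>C\<in>K. \<forall>f\<in>scott_maps D C. \<exists>!g. g \<in> scott_maps L C \<and> f = compose (carrier D) g \<kappa>"
  shows "\<kappa> \<in> E2 D L"
proof -
  obtain j where i: "i \<in> scott_maps two T" and j: "j \<in> scott_maps T two"
    and ji: "\<And>t. j (i t) = t"
    using T(2) by (elim dcpo_isoE) (auto simp: two_def)
  have uniq: "g y = h y" if g: "g \<in> scott_maps L two" and h: "h \<in> scott_maps L two"
    and eq: "\<And>x. x \<in> carrier D \<Longrightarrow> g (\<kappa> x) = h (\<kappa> x)" and y: "y \<in> carrier L" for g h y
  proof -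
    have "compose (carrier L) i g = compose (carrier L) i h"
      by (rule reflective_eq[OF univ \<kappa> T(1) compose_scott_maps[OF g i] compose_scott_maps[OF h i]])
        (use eq scott_maps_closed[OF \<kappa>] in \<open>simp add: compose_eq\<close>)
    then have "i (g y) = i (h y)"
      using y by (metis compose_eq)
    then show ?thesis
      using ji by metis
  qed
  have "orthogonal D L \<kappa> two"
    unfolding orthogonal_def
  proof (intro conjI ballI impI)
    fix f assume f: "f \<in> scott_maps D two"
    obtain g where g: "g \<in> scott_maps L T" "compose (carrier D) i f = compose (carrier D) g \<kappa>"
      using univ T(1) compose_scott_maps[OF f i] by blast
    have jg: "compose (carrier L) j g \<in> scott_maps L two"
      using g(1) j by (rule compose_scott_maps)
    have "f = compose (carrier D) (compose (carrier L) j g) \<kappa>"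
    proof (rule scott_maps_eqI[OF f compose_scott_maps[OF \<kappa> jg]])
      fix x assume x: "x \<in> carrier D"
      then have "g (\<kappa> x) = i (f x)"
        using g(2) by (metis compose_eq)
      then show "f x = compose (carrier D) (compose (carrier L) j g) \<kappa> x"
        using x ji scott_maps_closed[OF \<kappa>] by (simp add: compose_eq)
    qed
    then show "\<exists>g\<in>scott_maps L two. f = compose (carrier D) g \<kappa>"
      using jg by blast
  next
    fix g h y
    assume g: "g \<in> scott_maps L two" and h: "h \<in> scott_maps L two" and y: "y \<in> carrier L"
      and le: "\<forall>x\<in>carrier D. g (\<kappa> x) \<sqsubseteq>\<^bsub>two\<^esub> h (\<kappa> x)"
    \<comment> \<open>\<open>g \<le> h\<close> means \<open>g \<squnion> h = h\<close>, so uniqueness of extensions suffices.\<close>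
    have "(\<lambda>x\<in>carrier L. g x \<or> h x) y = h y"
      by (rule uniq[OF sup_scott_two[OF g h] h _ y])
        (use le scott_maps_closed[OF \<kappa>] in \<open>auto simp: two_def\<close>)
    then show "g y \<sqsubseteq>\<^bsub>two\<^esub> h y"
      using y by (auto simp: two_def)
  qed
  then show ?thesis
    using \<kappa> by (simp add: E2_iff)
qed

lemma R2_least:
  fixes K :: "'u gorder set"
  assumes lim: "strong_limit TYPE('u)" and K: "reflective K" "A \<in> K" "\<not> discrete A"
  shows "R2 \<subseteq> K"
proof
  fix C :: "'u gorder" assume C: "C \<in> R2"
  obtain T :: "'u gorder" and i where "T \<in> R2" and i: "dcpo_iso two T i"
    using ex_two_in_R2[OF lim] .
  then have T: "T \<in> K"
    using nondiscrete_two_in[OF K] R2_iff by blast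
  have CD: "C \<in> DCPO"
    using C R2_iff by blast
  obtain L \<kappa> where L: "L \<in> K" and \<kappa>: "\<kappa> \<in> scott_maps C L"
    and univ: "\<forall>D\<in>K. \<forall>f\<in>scott_maps C D. \<exists>!g. g \<in> scott_maps L D \<and> f = compose (carrier C) g \<kappa>"
    using K(1) CD unfolding reflective_def by blast
  have "L \<in> DCPO"
    using L K(1) unfolding reflective_def full_subcategory_def by blast
  \<comment> \<open>Membership of \<open>C\<close> in \<open>R2\<close> is used against its own
    reflection map; extending the identity then gives a retraction of \<open>L\<close> onto
    \<open>C\<close>.\<close>
  then have "orthogonal C L \<kappa> C"
    by (rule R2_orthogonal[OF C CD _ reflection_in_E2[OF T i \<kappa> univ]])
  then obtain r where r: "r \<in> scott_maps L C" "id_map C = compose (carrier C) r \<kappa>"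
    using orthogonal_ex id_map_scott by metis
  show "C \<in> K"
  proof (rule reflective_retract[OF K(1) L CD \<kappa> r(1)])
    fix x assume "x \<in> carrier C"
    then show "r (\<kappa> x) = x"
      using compose_eqD[OF r(2)] by (simp add: id_map_def)
  qed
qed

theorem corollary3p7:
  assumes "strong_limit TYPE('u)"
  shows "reflective (R2 :: 'u gorder set) \<and>
    (\<exists>A\<in>(R2 :: 'u gorder set). \<not> discrete A) \<and>
    (\<forall>K :: 'u gorder set. reflective K \<and> (\<exists>A\<in>K. \<not> discrete A) \<longrightarrow> R2 \<subseteq> K)"
proof (intro conjI allI impI)
  show "reflective (R2 :: 'u gorder set)"
    unfolding reflective_def using full_subcategory_R2 R2_reflection[OF assms] by blast
  obtain T :: "'u gorder" and i where T: "T \<in> R2" "dcpo_iso two T i"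
    using ex_two_in_R2[OF assms] .
  then obtain j where i: "i \<in> scott_maps two T" and ji: "\<And>t. j (i t) = t"
    by (elim dcpo_isoE) (auto simp: two_def)
  \<comment> \<open>The left inverse \<open>j\<close> keeps the two values of \<open>i\<close>
    apart, and monotonicity of \<open>i\<close> orders them.\<close>
  have "i False \<sqsubseteq>\<^bsub>T\<^esub> i True" "i False \<in> carrier T" "i True \<in> carrier T" "i False \<noteq> i True"
    using scott_maps_mono[OF i] scott_maps_closed[OF i] ji by (auto simp: two_def) metis
  then have "\<not> discrete T"
    unfolding discrete_def by blast
  then show "\<exists>A\<in>(R2 :: 'u gorder set). \<not> discrete A"
    using T(1) by blast
  fix K :: "'u gorder set"
  assume "reflective K \<and> (\<exists>A\<in>K. \<not> discrete A)"
  then show "R2 \<subseteq> K"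
    using R2_least[OF assms] by blast
qed

end
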